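(* Let $(X,d)$ be a complete metric space and let $T\colon X\to X$ be a mapping that is continuous (with respect to $d$) and is an A.M.-G.M. contraction, i.e. there exist $\alpha\in[0,1)$ and a semimetric $\delta\colon X\times X\to[0,\infty)$ such that $$\frac{d(Tx,Ty)+\delta(Tx,Ty)}{2}\le \alpha\,\big(d(x,y)\,\delta(x,y)\big)^{1/2}\quad\text{for all }x,y\in X.$$ Then $T$ is a Picard operator on $(X,d)$.
   Context: $X$ is a nonempty set. A semimetric on $X$ is a map $\delta\colon X\times X\to[0,\infty)$ such that $\delta(x,y)=0$ if and only if $x=y$, and $\delta(x,y)=\delta(y,x)$ for all $x,y\in X$ (no triangle inequality is required). A self-mapping $T$ of a metric space $(X,d)$ is called a Picard operator if $T$ has a unique fixed point $u\in X$ and for every $x\in X$ the sequence of iterates $(T^n x)$ converges to $u$ in $(X,d)$. *)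

theory Defs
  imports "HOL-Analysis.Analysis"
begin

text \<open>Metric spaces are given by an explicit carrier \<open>M\<close> and a distance \<open>d\<close>, as in the
  library locale \<open>Metric_space\<close>; all conditions below are relativised to the carrier.\<close>

definition semimetric_on :: "'a set \<Rightarrow> ('a \<Rightarrow> 'a \<Rightarrow> real) \<Rightarrow> bool" where
  "semimetric_on M \<delta> \<longleftrightarrow>
     (\<forall>x\<in>M. \<forall>y\<in>M. 0 \<le> \<delta> x y \<and> (\<delta> x y = 0 \<longleftrightarrow> x = y) \<and> \<delta> x y = \<delta> y x)"

definition amgm_contraction :: "'a set \<Rightarrow> ('a \<Rightarrow> 'a \<Rightarrow> real) \<Rightarrow> ('a \<Rightarrow> 'a) \<Rightarrow> bool" where
  "amgm_contraction M d T \<longleftrightarrow>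
     (\<exists>\<alpha> \<delta>. 0 \<le> \<alpha> \<and> \<alpha> < 1 \<and> semimetric_on M \<delta> \<and>
       (\<forall>x\<in>M. \<forall>y\<in>M. (d (T x) (T y) + \<delta> (T x) (T y)) / 2 \<le> \<alpha> * sqrt (d x y * \<delta> x y)))"

definition Picard_operator :: "'a set \<Rightarrow> ('a \<Rightarrow> 'a \<Rightarrow> real) \<Rightarrow> ('a \<Rightarrow> 'a) \<Rightarrow> bool" where
  "Picard_operator M d T \<longleftrightarrow>
     (\<exists>u\<in>M. T u = u \<and> (\<forall>v\<in>M. T v = v \<longrightarrow> v = u) \<and>
       (\<forall>x\<in>M. limitin (Metric_space.mtopology M d) (\<lambda>n. (T ^^ n) x) u sequentially))"

end

theory Submission
  imports Defs
begin

text \<open>By the AM-GM inequality, an A.M.-G.M. contraction contracts \<open>e = d + \<delta>\<close> by the factor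
  \<open>\<alpha>\<close>. Since \<open>d \<le> e\<close>, the \<open>d\<close>-distances of consecutive iterates decay geometrically,
  although \<open>e\<close> need not satisfy the triangle inequality. So every orbit converges; by continuity
  of \<open>T\<close> the limit is a fixed point, and the contraction of \<open>e\<close> makes fixed points unique.\<close>

text \<open>By the triangle inequality, the distance from \<open>s n\<close> to any later term is at
  most the geometric tail \<open>C * \<alpha> ^ n / (1 - \<alpha>)\<close>, which tends to
  0.\<close>

lemma (in Metric_space) MCauchy_if_geometric_steps:
  assumes M: "\<And>n. s n \<in> M"
    and "0 \<le> \<alpha>" "\<alpha> < 1"
    and step: "\<And>n. d (s n) (s (Suc n)) \<le> C * \<alpha> ^ n"
  shows "MCauchy s"
proof -
  \<comment> \<open>At index 0 the bound on the step is \<open>C\<close> itself. The sign is used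
    below to drop the factor \<open>1 - \<alpha> ^ k\<close>.\<close>
  have "0 \<le> C"
    using order_trans[OF nonneg step[of 0]] by simp
  \<comment> \<open>The right-hand side is the exact sum of \<open>C * \<alpha> ^ i\<close> for
    \<open>n \<le> i < n + k\<close>, so that the induction on \<open>k\<close> closes.\<close>
  have dist_add: "d (s n) (s (n + k)) \<le> C * \<alpha> ^ n * (1 - \<alpha> ^ k) / (1 - \<alpha>)" for n k
  proof (induction k)
    case 0
    then show ?case using M by simp
  next
    case (Suc k)
    have "d (s n) (s (n + Suc k)) \<le> d (s n) (s (n + k)) + d (s (n + k)) (s (Suc (n + k)))"
      using triangle M by simp
    also have "\<dots> \<le> C * \<alpha> ^ n * (1 - \<alpha> ^ k) / (1 - \<alpha>) + C * \<alpha> ^ (n + k)"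
      using Suc step by (intro add_mono)
    also have "\<dots> = C * \<alpha> ^ n * (1 - \<alpha> ^ Suc k) / (1 - \<alpha>)"
      using \<open>\<alpha> < 1\<close> by (simp add: field_simps power_add)
    finally show ?case .
  qed
  have dist_le: "d (s n) (s m) \<le> C * \<alpha> ^ n / (1 - \<alpha>)" if "n \<le> m" for n m
  proof -
    have "d (s n) (s m) \<le> C * \<alpha> ^ n * (1 - \<alpha> ^ (m - n)) / (1 - \<alpha>)"
      using dist_add[of n "m - n"] that by simp
    also have "\<dots> \<le> C * \<alpha> ^ n * 1 / (1 - \<alpha>)"
      using assms(2,3) \<open>0 \<le> C\<close> by (intro divide_right_mono mult_left_mono) auto
    finally show ?thesis by simp
  qed
  have "(\<lambda>n. C * \<alpha> ^ n / (1 - \<alpha>)) \<longlonglongrightarrow> C * 0 / (1 - \<alpha>)"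
    using assms(2,3) by (intro tendsto_intros LIMSEQ_realpow_zero) auto
  then have lim: "(\<lambda>n. C * \<alpha> ^ n / (1 - \<alpha>)) \<longlonglongrightarrow> 0"
    by simp
  show ?thesis
    unfolding MCauchy_def
  proof (intro conjI allI impI)
    show "range s \<subseteq> M" using M by auto
  next
    fix \<epsilon> :: real
    assume "0 < \<epsilon>"
    from order_tendstoD(2)[OF lim this]
    obtain N where N: "\<And>n. n \<ge> N \<Longrightarrow> C * \<alpha> ^ n / (1 - \<alpha>) < \<epsilon>"
      unfolding eventually_sequentially by blast
    have less: "d (s n) (s m) < \<epsilon>" if "N \<le> n" "n \<le> m" for n m
      using dist_le[OF that(2)] N[OF that(1)] by linarith
    have "d (s n) (s m) < \<epsilon>" if "N \<le> n" "N \<le> m" for n m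
      using less[of n m] less[of m n] that commute[of "s n" "s m"] by (cases "n \<le> m") auto
    then show "\<exists>N. \<forall>n n'. N \<le> n \<longrightarrow> N \<le> n' \<longrightarrow> d (s n) (s n') < \<epsilon>"
      by blast
  qed
qed

text \<open>The orbit shifted by one is the image of the orbit under \<open>T\<close>, so it tends
  to \<open>T u\<close> by continuity; as a tail of the orbit it also tends to
  \<open>u\<close>.\<close>

lemma (in Metric_space) limitin_orbit_imp_fixpoint:
  assumes cont: "continuous_map mtopology mtopology T"
    and lim: "limitin mtopology (\<lambda>n. (T ^^ n) x) u sequentially"
  shows "T u = u"
proof (rule limitin_metric_unique)
  show "limitin mtopology (\<lambda>n. (T ^^ Suc n) x) (T u) sequentially"
    using continuous_map_limit[OF cont lim] by (simp add: o_def)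
  show "limitin mtopology (\<lambda>n. (T ^^ Suc n) x) u sequentially"
    using limitin_sequentially_offset[OF lim, of 1] by simp
qed simp

text \<open>The function \<open>e\<close> stands for the sum of \<open>d\<close> and the semimetric.
  Decay is proved for \<open>e\<close> and passed to \<open>d\<close> by \<open>dom\<close>, since
  the triangle inequality is at hand for \<open>d\<close>.\<close>

lemma (in Metric_space) Picard_operator_if_dominating_contraction:
  assumes "M \<noteq> {}" "mcomplete" and T: "T \<in> M \<rightarrow> M"
    and cont: "continuous_map mtopology mtopology T"
    and \<alpha>: "0 \<le> \<alpha>" "\<alpha> < 1"
    and dom: "\<And>x y. x \<in> M \<Longrightarrow> y \<in> M \<Longrightarrow> d x y \<le> e x y"
    and contr: "\<And>x y. x \<in> M \<Longrightarrow> y \<in> M \<Longrightarrow> e (T x) (T y) \<le> \<alpha> * e x y"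
  shows "Picard_operator M d T"
proof -
  have uniq: "u = v" if uv: "u \<in> M" "v \<in> M" "T u = u" "T v = v" for u v
  proof -
    \<comment> \<open>At two fixed points the contraction reads
      \<open>e u v \<le> \<alpha> * e u v\<close>.\<close>
    have "(1 - \<alpha>) * e u v \<le> 0"
      using contr[OF uv(1,2)] uv(3,4) by (simp add: algebra_simps)
    then have "e u v \<le> 0"
      using \<alpha> by (simp add: mult_le_0_iff)
    then show ?thesis
      using dom[OF uv(1,2)] nonneg[of u v] zero[OF uv(1,2)] by linarith
  qed
  have lim: "\<exists>u\<in>M. T u = u \<and> limitin mtopology (\<lambda>n. (T ^^ n) x) u sequentially"
    if x: "x \<in> M" for x
  proof -
    have orbit: "(T ^^ n) y \<in> M" if "y \<in> M" for n y
      using T that by (induction n) auto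
    have Tx: "T x \<in> M" using T x by auto
    \<comment> \<open>Consecutive iterates are viewed as the orbits of \<open>x\<close> and
      \<open>T x\<close> at the same time \<open>n\<close>, so each induction step is one use of
      \<open>contr\<close>.\<close>
    have "e ((T ^^ n) x) ((T ^^ n) (T x)) \<le> e x (T x) * \<alpha> ^ n" for n
    proof (induction n)
      case (Suc n)
      have "e ((T ^^ Suc n) x) ((T ^^ Suc n) (T x)) \<le> \<alpha> * e ((T ^^ n) x) ((T ^^ n) (T x))"
        using contr[OF orbit[OF x] orbit[OF Tx]] by simp
      also have "\<dots> \<le> \<alpha> * (e x (T x) * \<alpha> ^ n)"
        using Suc \<alpha>(1) by (rule mult_left_mono)
      finally show ?case by (simp add: mult_ac)
    qed simp
    then have "d ((T ^^ n) x) ((T ^^ Suc n) x) \<le> e x (T x) * \<alpha> ^ n" for n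
      using order_trans[OF dom[OF orbit[OF x] orbit[OF Tx]]] by (simp add: funpow_swap1)
    then have "MCauchy (\<lambda>n. (T ^^ n) x)"
      by (intro MCauchy_if_geometric_steps[OF orbit[OF x] \<alpha>])
    then obtain u where u: "limitin mtopology (\<lambda>n. (T ^^ n) x) u sequentially"
      using \<open>mcomplete\<close> unfolding mcomplete_def by blast
    then show ?thesis
      using limitin_orbit_imp_fixpoint[OF cont u] limitin_mspace by blast
  qed
  \<comment> \<open>In \<open>lim\<close> the limit may depend on the starting point; being fixed
    points, all these limits equal this \<open>u\<close> by \<open>uniq\<close>.\<close>
  from \<open>M \<noteq> {}\<close> lim obtain u where u: "u \<in> M" "T u = u"
    by blast
  show ?thesis
    unfolding Picard_operator_def
    using u uniq lim by metis
qed

text \<open>This is AM-GM, \<open>sqrt (a * b) \<le> (a + b) / 2\<close>, scaled by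
  \<open>\<alpha>\<close>; the two halves cancel.\<close>

lemma le_mult_add_if_half_le_mult_sqrt:
  fixes a b c \<alpha> :: real
  assumes "0 \<le> a" "0 \<le> b" "0 \<le> \<alpha>" "c / 2 \<le> \<alpha> * sqrt (a * b)"
  shows "c \<le> \<alpha> * (a + b)"
  using mult_left_mono[OF arith_geo_mean_sqrt[OF assms(1,2)] assms(3)] assms(4)
  by simp

theorem theorem2p2:
  fixes M :: "'a set" and d :: "'a \<Rightarrow> 'a \<Rightarrow> real" and T :: "'a \<Rightarrow> 'a"
  assumes "M \<noteq> {}"
    and "Metric_space M d"
    and "Metric_space.mcomplete M d"
    and "T \<in> M \<rightarrow> M"
    and "continuous_map (Metric_space.mtopology M d) (Metric_space.mtopology M d) T"
    and "amgm_contraction M d T"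
  shows "Picard_operator M d T"
proof -
  interpret Metric_space M d by fact
  obtain \<alpha> \<delta> where \<alpha>: "0 \<le> \<alpha>" "\<alpha> < 1" and "semimetric_on M \<delta>"
    and contr: "\<And>x y. x \<in> M \<Longrightarrow> y \<in> M \<Longrightarrow>
      (d (T x) (T y) + \<delta> (T x) (T y)) / 2 \<le> \<alpha> * sqrt (d x y * \<delta> x y)"
    using assms(6) unfolding amgm_contraction_def by blast
  then have \<delta>: "\<And>x y. x \<in> M \<Longrightarrow> y \<in> M \<Longrightarrow> 0 \<le> \<delta> x y"
    unfolding semimetric_on_def by blast
  show ?thesis
  \<comment> \<open>The dominating function is \<open>d x y + \<delta> x y\<close>; it dominates
    \<open>d\<close> because \<open>\<delta>\<close> is nonnegative on \<open>M\<close>.\<close>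
  proof (rule Picard_operator_if_dominating_contraction[OF assms(1,3,4,5) \<alpha>])
    fix x y assume "x \<in> M" "y \<in> M"
    then show "d x y \<le> d x y + \<delta> x y"
      and "d (T x) (T y) + \<delta> (T x) (T y) \<le> \<alpha> * (d x y + \<delta> x y)"
      using \<delta> contr le_mult_add_if_half_le_mult_sqrt[OF nonneg \<delta> \<alpha>(1)] by auto
  qed
qed

end
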